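(* Let $E$ be a Banach lattice and let $\mathcal{P}$ be a linear subspace of $\mathrm{L}(E)$ that is closed in the operator norm. Then $$\|T\|_{\text{r-}\mathcal{P}}=\inf\{\|S\|:\pm T\le S\in\mathcal{P}\}$$ defines a norm on the space $\text{r-}\mathcal{P}(E)$ of all $\text{r-}\mathcal{P}$-operators on $E$. Furthermore, $\|T\|_{\text{r-}\mathcal{P}}\ge\|T\|_r\ge\|T\|$ for all $T\in\text{r-}\mathcal{P}(E)$, where $\|T\|_r:=\inf\{\|S\|:\pm T\le S\in\mathrm{L}(E)\}$ is the regular norm, and $(\text{r-}\mathcal{P}(E),\|\cdot\|_{\text{r-}\mathcal{P}})$ is a Banach space.
   Context: $\mathrm{L}(E)$ is the space of bounded linear operators on $E$, ordered by $S\le T$ iff $Sx\le Tx$ for all $x\ge 0$ in $E$. An operator $T\in\mathrm{L}(E)$ is an $\text{r-}\mathcal{P}$-operator if $T=T_1-T_2$ for some positive operators $T_1,T_2\in\mathcal{P}$; $\text{r-}\mathcal{P}(E)$ is the set of all such operators. *)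

theory Defs
  imports "HOL-Analysis.Analysis" "HOL-Library.Lattice_Algebras"
begin

text \<open>The modulus \<open>\<bar>x\<bar>\<close> is \<open>sup x (- x)\<close>, by the axiom of \<open>lattice_ab_group_add_abs\<close>.\<close>

class banach_lattice = banach + ordered_real_vector + lattice_ab_group_add_abs +
  assumes norm_lattice: "\<bar>x\<bar> \<le> \<bar>y\<bar> \<Longrightarrow> norm x \<le> norm y"

definition op_le ::
    "('a :: banach_lattice \<Rightarrow>\<^sub>L 'a) \<Rightarrow> ('a \<Rightarrow>\<^sub>L 'a) \<Rightarrow> bool"  (infix "\<preceq>" 50) where
  "S \<preceq> T \<longleftrightarrow> (\<forall>x\<ge>0. blinfun_apply S x \<le> blinfun_apply T x)"

definition r_ops ::
    "('a :: banach_lattice \<Rightarrow>\<^sub>L 'a) set \<Rightarrow> ('a \<Rightarrow>\<^sub>L 'a) set" where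
  "r_ops P = {T1 - T2 | T1 T2. T1 \<in> P \<and> T2 \<in> P \<and> 0 \<preceq> T1 \<and> 0 \<preceq> T2}"

definition dominating ::
    "('a :: banach_lattice \<Rightarrow>\<^sub>L 'a) set \<Rightarrow> ('a \<Rightarrow>\<^sub>L 'a) \<Rightarrow> ('a \<Rightarrow>\<^sub>L 'a) set" where
  "dominating P T = {S \<in> P. T \<preceq> S \<and> - T \<preceq> S}"

text \<open>
  These are infima in \<open>real\<close>. The sets are bounded below by \<open>0\<close>, so the value is the
  intended one as soon as \<open>dominating P T\<close> is nonempty.
\<close>

definition rP_norm ::
    "('a :: banach_lattice \<Rightarrow>\<^sub>L 'a) set \<Rightarrow> ('a \<Rightarrow>\<^sub>L 'a) \<Rightarrow> real" where
  "rP_norm P T = (INF S \<in> dominating P T. norm S)"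

definition regular_norm :: "('a :: banach_lattice \<Rightarrow>\<^sub>L 'a) \<Rightarrow> real" where
  "regular_norm T = (INF S \<in> dominating UNIV T. norm S)"

definition norm_on :: "'v :: real_vector set \<Rightarrow> ('v \<Rightarrow> real) \<Rightarrow> bool" where
  "norm_on V N \<longleftrightarrow> subspace V \<and>
     (\<forall>x\<in>V. 0 \<le> N x) \<and>
     (\<forall>x\<in>V. N x = 0 \<longleftrightarrow> x = 0) \<and>
     (\<forall>c. \<forall>x\<in>V. N (c *\<^sub>R x) = \<bar>c\<bar> * N x) \<and>
     (\<forall>x\<in>V. \<forall>y\<in>V. N (x + y) \<le> N x + N y)"

text \<open>
  \<open>Metric_space\<close> requires its distance function to be nonnegative and symmetric on the whole
  type, whereas nothing is known about \<open>N\<close> outside \<open>V\<close>; hence the case distinction. The value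
  chosen outside \<open>V\<close> has no influence on completeness.
\<close>

definition dist_on :: "'v :: real_vector set \<Rightarrow> ('v \<Rightarrow> real) \<Rightarrow> 'v \<Rightarrow> 'v \<Rightarrow> real" where
  "dist_on V N x y = (if x \<in> V \<and> y \<in> V then N (x - y) else 0)"

definition banach_on :: "'v :: real_vector set \<Rightarrow> ('v \<Rightarrow> real) \<Rightarrow> bool" where
  "banach_on V N \<longleftrightarrow> norm_on V N \<and> Metric_space.mcomplete V (dist_on V N)"

end

theory Submission
  imports Defs
begin

text \<open>
  If \<open>\<plusminus>T \<le> S\<close> then \<open>\<bar>T x\<bar> \<le> S \<bar>x\<bar>\<close>, hence \<open>\<parallel>T\<parallel> \<le> \<parallel>S\<parallel>\<close>; this gives the inequalities between the
  three norms and definiteness. For completeness, let \<open>\<sigma>\<close> be a sequence with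
  \<open>\<parallel>\<sigma>\<^sub>n - \<sigma>\<^sub>n\<^sub>+\<^sub>1\<parallel> < 2\<^sup>-\<^sup>n\<close> in the \<open>r-P\<close>-norm, and choose \<open>S\<^sub>n \<in> P\<close> dominating
  \<open>\<sigma>\<^sub>n\<^sub>+\<^sub>1 - \<sigma>\<^sub>n\<close> with \<open>\<parallel>S\<^sub>n\<parallel> < 2\<^sup>-\<^sup>n\<close>. Then \<open>\<sigma>\<close> has a limit \<open>T\<close> in operator norm, and
  as \<open>P\<close> and the positive cone are closed, the tail \<open>\<Sum>n\<ge>k. S\<^sub>n\<close> lies in \<open>P\<close> and dominates
  \<open>T - \<sigma>\<^sub>k\<close>. Its norm is at most \<open>2 \<cdot> 2\<^sup>-\<^sup>k\<close>, so \<open>\<sigma>\<close> converges to \<open>T\<close> in the \<open>r-P\<close>-norm.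
\<close>

section \<open>Banach lattices\<close>

lemma norm_abs_lattice: "norm \<bar>x\<bar> = norm (x :: 'a :: banach_lattice)"
  by (intro order.antisym norm_lattice) simp_all

lemma norm_mono_lattice:
  fixes x y :: "'a :: banach_lattice"
  assumes "\<bar>x\<bar> \<le> y"
  shows "norm x \<le> norm y"
  by (rule norm_lattice) (rule order_trans[OF assms abs_ge_self])

text \<open>The modulus is continuous: the reverse triangle inequality in the lattice passes to
  norms because the norm is monotone in the modulus.\<close>

lemma tendsto_abs_lattice:
  fixes f :: "'b \<Rightarrow> 'a :: banach_lattice"
  assumes "(f \<longlongrightarrow> l) F"
  shows "((\<lambda>x. \<bar>f x\<bar>) \<longlongrightarrow> \<bar>l\<bar>) F"
proof -
  have "((\<lambda>x. norm (f x - l)) \<longlongrightarrow> 0) F"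
    using assms by (simp add: tendsto_norm_zero_iff LIM_zero_iff)
  moreover have "norm (\<bar>f x\<bar> - \<bar>l\<bar>) \<le> norm (f x - l)" for x
    by (intro norm_lattice abs_triangle_ineq3)
  ultimately have "((\<lambda>x. \<bar>f x\<bar> - \<bar>l\<bar>) \<longlongrightarrow> 0) F"
    by (intro Lim_null_comparison[of "\<lambda>x. \<bar>f x\<bar> - \<bar>l\<bar>" "\<lambda>x. norm (f x - l)"] always_eventually allI)
  then show ?thesis
    by (simp add: LIM_zero_iff)
qed

text \<open>This is closedness of the positive cone, applied to \<open>g n - f n\<close>: positive
  elements are the fixed points of the modulus, which is continuous.\<close>

lemma LIMSEQ_le_lattice:
  fixes f g :: "nat \<Rightarrow> 'a :: banach_lattice"
  assumes "f \<longlonglongrightarrow> a" "g \<longlonglongrightarrow> b" "\<And>n. f n \<le> g n"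
  shows "a \<le> b"
proof -
  have lim: "(\<lambda>n. g n - f n) \<longlonglongrightarrow> b - a"
    by (intro tendsto_diff assms)
  have "(\<lambda>n. \<bar>g n - f n\<bar>) = (\<lambda>n. g n - f n)"
    using assms(3) by simp
  then have "\<bar>b - a\<bar> = b - a"
    using LIMSEQ_unique[OF tendsto_abs_lattice[OF lim]] lim by simp
  then have "0 \<le> b - a"
    by (metis abs_ge_zero)
  then show ?thesis
    by simp
qed

section \<open>The order on operators\<close>

lemma op_le_iff_diff: "S \<preceq> T \<longleftrightarrow> 0 \<preceq> T - S"
  by (simp add: op_le_def blinfun.bilinear_simps)

lemma op_le_refl: "S \<preceq> S"
  by (simp add: op_le_def)

lemma op_le_add: "A \<preceq> B \<Longrightarrow> C \<preceq> D \<Longrightarrow> A + C \<preceq> B + D"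
  by (simp add: op_le_def blinfun.bilinear_simps add_mono)

lemma op_le_scaleR: "0 \<le> c \<Longrightarrow> A \<preceq> B \<Longrightarrow> c *\<^sub>R A \<preceq> c *\<^sub>R B"
  by (simp add: op_le_def blinfun.bilinear_simps scaleR_left_mono)

text \<open>Convergence in operator norm implies pointwise convergence, so closedness of the
  positive cone of the space carries over to operators.\<close>

lemma op_le_LIMSEQ:
  assumes "F \<longlonglongrightarrow> A" "G \<longlonglongrightarrow> B" "\<And>n. F n \<preceq> G n"
  shows "A \<preceq> B"
  unfolding op_le_def
proof (intro allI impI)
  fix x :: 'a assume "0 \<le> x"
  show "blinfun_apply A x \<le> blinfun_apply B x"
  proof (rule LIMSEQ_le_lattice)
    show "(\<lambda>n. blinfun_apply (F n) x) \<longlonglongrightarrow> blinfun_apply A x"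
      by (intro blinfun.tendsto assms tendsto_const)
    show "(\<lambda>n. blinfun_apply (G n) x) \<longlonglongrightarrow> blinfun_apply B x"
      by (intro blinfun.tendsto assms tendsto_const)
    show "blinfun_apply (F n) x \<le> blinfun_apply (G n) x" for n
      using assms(3) \<open>0 \<le> x\<close> by (simp add: op_le_def)
  qed
qed

lemma op_le_sums:
  assumes "F sums A" "G sums B" "\<And>n. F n \<preceq> G n"
  shows "A \<preceq> B"
proof (rule op_le_LIMSEQ)
  show "(\<lambda>n. \<Sum>i<n. F i) \<longlonglongrightarrow> A" "(\<lambda>n. \<Sum>i<n. G i) \<longlonglongrightarrow> B"
    using assms by (simp_all add: sums_def)
  show "(\<Sum>i<n. F i) \<preceq> (\<Sum>i<n. G i)" for n
    by (induction n) (simp_all add: op_le_refl op_le_add assms)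
qed

section \<open>Dominating operators\<close>

lemma abs_apply_le_dominating:
  assumes "S \<in> dominating P T"
  shows "\<bar>blinfun_apply T x\<bar> \<le> blinfun_apply S \<bar>x\<bar>"
proof -
  have *: "\<bar>blinfun_apply T y\<bar> \<le> blinfun_apply S y" if "0 \<le> y" for y
    using assms that by (intro abs_leI) (auto simp: dominating_def op_le_def blinfun.bilinear_simps)
  \<comment> \<open>The bound holds on the positive cone, so \<open>x\<close> is split into its
    positive and negative parts. As \<open>nprt x\<close> is \<le> 0, the negative part in the usual
    sense is \<open>- nprt x\<close>.\<close>
  have "blinfun_apply T x = blinfun_apply T (pprt x) - blinfun_apply T (- nprt x)"
    by (metis blinfun.diff_right diff_minus_eq_add prts)
  then have "\<bar>blinfun_apply T x\<bar> \<le> \<bar>blinfun_apply T (pprt x)\<bar> + \<bar>blinfun_apply T (- nprt x)\<bar>"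
    by (metis abs_triangle_ineq4)
  also have "\<dots> \<le> blinfun_apply S (pprt x) + blinfun_apply S (- nprt x)"
    by (intro add_mono *) simp_all
  also have "\<dots> = blinfun_apply S \<bar>x\<bar>"
    by (simp add: abs_prts blinfun.bilinear_simps)
  finally show ?thesis .
qed

lemma norm_le_dominating:
  assumes "S \<in> dominating P T"
  shows "norm T \<le> norm S"
proof (rule norm_blinfun_bound)
  fix x
  have "norm (blinfun_apply T x) \<le> norm (blinfun_apply S \<bar>x\<bar>)"
    by (rule norm_mono_lattice[OF abs_apply_le_dominating[OF assms]])
  also have "\<dots> \<le> norm S * norm x"
    using norm_blinfun[of S "\<bar>x\<bar>"] by (simp add: norm_abs_lattice)
  finally show "norm (blinfun_apply T x) \<le> norm S * norm x" .
qed simp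

lemma dominating_zero: "subspace P \<Longrightarrow> 0 \<in> dominating P 0"
  by (simp add: dominating_def op_le_refl subspace_0)

lemma dominating_minus: "dominating P (- T) = dominating P T"
  by (auto simp: dominating_def)

lemma dominating_add:
  assumes "subspace P" "A \<in> dominating P S" "B \<in> dominating P T"
  shows "A + B \<in> dominating P (S + T)"
  using assms op_le_add[of S A T B] op_le_add[of "- S" A "- T" B]
  by (auto simp: dominating_def subspace_add)

text \<open>For negative \<open>c\<close> the two inequalities bounding \<open>T\<close> and
  \<open>- T\<close> exchange their roles.\<close>

lemma dominating_scaleR:
  assumes "subspace P" "S \<in> dominating P T"
  shows "\<bar>c\<bar> *\<^sub>R S \<in> dominating P (c *\<^sub>R T)"
  using assms op_le_scaleR[of "\<bar>c\<bar>" T S] op_le_scaleR[of "\<bar>c\<bar>" "- T" S]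
  by (cases "c \<ge> 0") (auto simp: dominating_def subspace_scale subspace_neg)

text \<open>A difference \<open>A - B\<close> of positive operators is dominated by
  \<open>A + B\<close>. Conversely, if \<open>S\<close> dominates \<open>T\<close>, then
  \<open>T\<close> is the difference of the positive operators \<open>(S + T) / 2\<close> and
  \<open>(S - T) / 2\<close>.\<close>

lemma r_ops_iff_dominating:
  assumes "subspace P"
  shows "T \<in> r_ops P \<longleftrightarrow> T \<in> P \<and> dominating P T \<noteq> {}"
proof
  assume "T \<in> r_ops P"
  then obtain A B where T: "T = A - B" and AB: "A \<in> P" "B \<in> P" "0 \<preceq> A" "0 \<preceq> B"
    by (auto simp: r_ops_def)
  have "A + B \<in> dominating P T"
    using AB op_le_add[OF AB(3) AB(3)] op_le_add[OF AB(4) AB(4)] unfolding dominating_def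
    by (simp add: T subspace_add assms op_le_iff_diff[of "A - B"] op_le_iff_diff[of "B - A"])
  then show "T \<in> P \<and> dominating P T \<noteq> {}"
    using AB by (auto simp: T subspace_diff assms)
next
  assume "T \<in> P \<and> dominating P T \<noteq> {}"
  then obtain S where T: "T \<in> P" and S: "S \<in> P" "T \<preceq> S" "- T \<preceq> S"
    by (auto simp: dominating_def)
  \<comment> \<open>The sum \<open>S + T\<close> is written \<open>S - - T\<close> to match
    \<open>op_le_iff_diff\<close> at \<open>- T\<close>.\<close>
  let ?A = "(1/2) *\<^sub>R (S - - T)" and ?B = "(1/2) *\<^sub>R (S - T)"
  have "?A - ?B = T"
    by (simp add: algebra_simps flip: scaleR_add_left)
  moreover have "?A \<in> P" "?B \<in> P"
    using assms S(1) T by (auto intro!: subspace_scale subspace_diff subspace_add)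
  moreover have "0 \<preceq> ?A" "0 \<preceq> ?B"
    using op_le_scaleR[of "1/2", OF _ S(3)[unfolded op_le_iff_diff[of "- T"]]]
      op_le_scaleR[of "1/2", OF _ S(2)[unfolded op_le_iff_diff[of T]]]
    by simp_all
  ultimately show "T \<in> r_ops P"
    unfolding r_ops_def by force
qed

lemma subspace_r_ops:
  assumes "subspace P"
  shows "subspace (r_ops P)"
proof (rule subspaceI)
  show "0 \<in> r_ops P"
    using dominating_zero[OF assms] by (auto simp: r_ops_iff_dominating assms subspace_0)
next
  fix S T assume "S \<in> r_ops P" "T \<in> r_ops P"
  then show "S + T \<in> r_ops P"
    using dominating_add[OF assms, of _ S _ T]
    by (force simp: r_ops_iff_dominating assms subspace_add)
next
  fix c T assume "T \<in> r_ops P"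
  then show "c *\<^sub>R T \<in> r_ops P"
    using dominating_scaleR[OF assms, of _ T c]
    by (force simp: r_ops_iff_dominating assms subspace_scale)
qed

section \<open>The norm\<close>

lemma bdd_below_norm_image: "bdd_below (norm ` A)"
  by (rule bdd_belowI[of _ 0]) auto

lemma rP_norm_le: "S \<in> dominating P T \<Longrightarrow> rP_norm P T \<le> norm S"
  unfolding rP_norm_def by (intro cINF_lower bdd_below_norm_image)

text \<open>Membership in \<open>r_ops P\<close> makes the set under the infimum nonempty, so the
  infimum really is the greatest lower bound.\<close>

lemma rP_norm_greatest:
  assumes "subspace P" "T \<in> r_ops P" "\<And>S. S \<in> dominating P T \<Longrightarrow> c \<le> norm S"
  shows "c \<le> rP_norm P T"
  unfolding rP_norm_def
  using assms by (intro cINF_greatest) (auto simp: r_ops_iff_dominating)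

lemma rP_norm_lessE:
  assumes "subspace P" "T \<in> r_ops P" "rP_norm P T < c"
  obtains S where "S \<in> dominating P T" "norm S < c"
  using rP_norm_greatest[OF assms(1,2), of c] assms(3) by force

lemma rP_norm_minus: "rP_norm P (- T) = rP_norm P T"
  by (simp add: rP_norm_def dominating_minus)

lemma regular_norm_eq: "regular_norm = rP_norm UNIV"
  by (simp add: fun_eq_iff regular_norm_def rP_norm_def)

lemma norm_le_rP_norm:
  assumes "subspace P" "T \<in> r_ops P"
  shows "norm T \<le> rP_norm P T"
  using assms by (rule rP_norm_greatest) (rule norm_le_dominating)

text \<open>Every dominating operator in \<open>P\<close> also competes in the infimum over all
  bounded operators.\<close>

lemma regular_norm_le_rP_norm:
  assumes "subspace P" "T \<in> r_ops P"
  shows "regular_norm T \<le> rP_norm P T"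
  using assms by (rule rP_norm_greatest) (auto simp: regular_norm_eq dominating_def intro: rP_norm_le)

lemma r_ops_mono: "P \<subseteq> Q \<Longrightarrow> r_ops P \<subseteq> r_ops Q"
  by (auto simp: r_ops_def)

lemma norm_le_regular_norm:
  assumes "T \<in> r_ops P"
  shows "norm T \<le> regular_norm T"
  unfolding regular_norm_eq using assms r_ops_mono[of P UNIV] by (intro norm_le_rP_norm) auto

text \<open>Sums of dominating operators dominate the sum; the infimum is then taken over one
  summand at a time.\<close>

lemma rP_norm_add_le:
  assumes P: "subspace P" and S: "S \<in> r_ops P" and T: "T \<in> r_ops P"
  shows "rP_norm P (S + T) \<le> rP_norm P S + rP_norm P T"
proof -
  have *: "rP_norm P (S + T) \<le> norm A + norm B"
    if "A \<in> dominating P S" "B \<in> dominating P T" for A B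
    using rP_norm_le[OF dominating_add[OF P that]] norm_triangle_ineq[of A B] by linarith
  have "rP_norm P (S + T) - norm A \<le> rP_norm P T" if "A \<in> dominating P S" for A
    using *[OF that] by (intro rP_norm_greatest[OF P T]) (simp add: algebra_simps)
  then have "rP_norm P (S + T) - rP_norm P T \<le> rP_norm P S"
    by (intro rP_norm_greatest[OF P S]) (simp add: algebra_simps)
  then show ?thesis
    by simp
qed

lemma rP_norm_zero: "subspace P \<Longrightarrow> rP_norm P 0 = 0"
  using rP_norm_le[OF dominating_zero] norm_le_rP_norm[OF _ subspace_0[OF subspace_r_ops]]
  by (metis norm_zero order.antisym)

lemma rP_norm_scaleR_le:
  assumes P: "subspace P" and T: "T \<in> r_ops P"
  shows "rP_norm P (c *\<^sub>R T) \<le> \<bar>c\<bar> * rP_norm P T"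
proof (cases "c = 0")
  case True
  then show ?thesis
    by (simp add: rP_norm_zero P)
next
  case False
  have "rP_norm P (c *\<^sub>R T) \<le> \<bar>c\<bar> * norm S" if "S \<in> dominating P T" for S
    using rP_norm_le[OF dominating_scaleR[OF P that]] by simp
  then have "rP_norm P (c *\<^sub>R T) / \<bar>c\<bar> \<le> rP_norm P T"
    using False by (intro rP_norm_greatest[OF P T]) (simp add: field_simps)
  then show ?thesis
    using False by (simp add: field_simps)
qed

text \<open>For nonzero \<open>c\<close>, the reverse inequality is \<open>rP_norm_scaleR_le\<close>
  applied to \<open>c *\<^sub>R T\<close> and the factor \<open>inverse c\<close>.\<close>

lemma rP_norm_scaleR:
  assumes P: "subspace P" and T: "T \<in> r_ops P"
  shows "rP_norm P (c *\<^sub>R T) = \<bar>c\<bar> * rP_norm P T"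
proof (cases "c = 0")
  case True
  then show ?thesis
    by (simp add: rP_norm_zero P)
next
  case False
  have "rP_norm P T \<le> rP_norm P (c *\<^sub>R T) / \<bar>c\<bar>"
    using rP_norm_scaleR_le[OF P subspace_scale[OF subspace_r_ops[OF P] T, of c], of "inverse c"] False
    by (simp add: divide_inverse mult.commute)
  then have "\<bar>c\<bar> * rP_norm P T \<le> rP_norm P (c *\<^sub>R T)"
    using False by (simp add: field_simps)
  with rP_norm_scaleR_le[OF P T, of c] show ?thesis
    by linarith
qed

lemma norm_on_rP_norm:
  assumes P: "subspace P"
  shows "norm_on (r_ops P) (rP_norm P)"
  unfolding norm_on_def
proof (intro conjI ballI allI)
  fix T assume T: "T \<in> r_ops P"
  show "0 \<le> rP_norm P T"
    using norm_le_rP_norm[OF P T] norm_ge_zero[of T] by linarith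
  show "rP_norm P T = 0 \<longleftrightarrow> T = 0"
    using norm_le_rP_norm[OF P T] rP_norm_zero[OF P] by auto
qed (simp_all add: P subspace_r_ops rP_norm_scaleR rP_norm_add_le)

section \<open>Completeness\<close>

lemma Metric_space_dist_on:
  assumes "norm_on V N"
  shows "Metric_space V (dist_on V N)"
proof
  have V: "subspace V"
    using assms by (simp add: norm_on_def)
  have diff: "x - y \<in> V" if "x \<in> V" "y \<in> V" for x y
    using V that by (rule subspace_diff)
  show "0 \<le> dist_on V N x y" for x y
    using assms diff by (auto simp: dist_on_def norm_on_def)
  \<comment> \<open>Symmetry is homogeneity with the scalar -1.\<close>
  have "N (x - y) = N (y - x)" if "x \<in> V" "y \<in> V" for x y
  proof -
    have "N ((- 1) *\<^sub>R (y - x)) = \<bar>- 1\<bar> * N (y - x)"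
      using assms diff[OF that(2,1)] unfolding norm_on_def by blast
    then show ?thesis
      by simp
  qed
  then show "dist_on V N x y = dist_on V N y x" for x y
    by (simp add: dist_on_def)
  show "dist_on V N x y = 0 \<longleftrightarrow> x = y" if "x \<in> V" "y \<in> V" for x y
    using assms diff[OF that] that by (simp add: dist_on_def norm_on_def)
  show "dist_on V N x z \<le> dist_on V N x y + dist_on V N y z"
    if "x \<in> V" "y \<in> V" "z \<in> V" for x y z
  proof -
    have "N ((x - y) + (y - z)) \<le> N (x - y) + N (y - z)"
      using assms diff[OF that(1,2)] diff[OF that(2,3)] unfolding norm_on_def by blast
    then show ?thesis
      using that by (simp add: dist_on_def)
  qed
qed

text \<open>Every Cauchy sequence has a subsequence whose successive distances are below
  \<open>(1/2) ^ n\<close>, and it converges as soon as this subsequence does.\<close>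

lemma (in Metric_space) mcomplete_if_fast_Cauchy_convergent:
  assumes "\<And>\<sigma>. range \<sigma> \<subseteq> M \<Longrightarrow> (\<And>n. d (\<sigma> n) (\<sigma> (Suc n)) < (1/2) ^ n) \<Longrightarrow>
             \<exists>l. limitin mtopology \<sigma> l sequentially"
  shows mcomplete
  unfolding mcomplete_def
proof (intro allI impI)
  fix \<sigma> assume \<sigma>: "MCauchy \<sigma>"
  \<comment> \<open>The index \<open>r n\<close> is a Cauchy threshold for \<open>(1/2) ^ n\<close>;
    the thresholds are enlarged to be strictly increasing.\<close>
  have "\<exists>r. \<forall>n. (\<forall>i\<ge>r n. \<forall>j\<ge>r n. d (\<sigma> i) (\<sigma> j) < (1/2) ^ n) \<and> r n < r (Suc n)"
  proof (rule dependent_nat_choice)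
    show "\<exists>m. \<forall>i\<ge>m. \<forall>j\<ge>m. d (\<sigma> i) (\<sigma> j) < (1/2) ^ 0"
      using \<sigma> unfolding MCauchy_def by (metis power_0 zero_less_one)
    fix m n
    have "(0 :: real) < (1/2) ^ Suc n"
      by simp
    then obtain N where "\<forall>i\<ge>N. \<forall>j\<ge>N. d (\<sigma> i) (\<sigma> j) < (1/2) ^ Suc n"
      using \<sigma> unfolding MCauchy_def by metis
    then show "\<exists>k. (\<forall>i\<ge>k. \<forall>j\<ge>k. d (\<sigma> i) (\<sigma> j) < (1/2) ^ Suc n) \<and> m < k"
      by (intro exI[of _ "max N (Suc m)"]) auto
  qed
  then obtain r where r: "\<And>n i j. r n \<le> i \<Longrightarrow> r n \<le> j \<Longrightarrow> d (\<sigma> i) (\<sigma> j) < (1/2) ^ n"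
    and r_less: "\<And>n. r n < r (Suc n)"
    by metis
  then have mono: "strict_mono r"
    by (simp add: strict_mono_Suc_iff)
  have "\<exists>l. limitin mtopology (\<sigma> \<circ> r) l sequentially"
  proof (rule assms)
    show "range (\<sigma> \<circ> r) \<subseteq> M"
      using \<sigma> by (auto simp: MCauchy_def)
    show "d ((\<sigma> \<circ> r) n) ((\<sigma> \<circ> r) (Suc n)) < (1/2) ^ n" for n
      using r[of n "r n" "r (Suc n)"] r_less[of n] by simp
  qed
  then show "\<exists>l. limitin mtopology \<sigma> l sequentially"
    using MCauchy_convergent_subsequence[OF \<sigma> mono] by blast
qed

lemma sums_in_closed_subspace:
  assumes "subspace P" "closed P" "\<And>n. f n \<in> P" "f sums s"
  shows "s \<in> P"
  using assms(2) _ assms(4)[unfolded sums_def]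
  by (rule closed_sequentially) (intro subspace_sum assms)

lemma r_ops_fast_Cauchy_convergent:
  assumes P: "subspace P" "closed P"
    and \<sigma>: "\<And>n. \<sigma> n \<in> r_ops P"
    and fast: "\<And>n. rP_norm P (\<sigma> n - \<sigma> (Suc n)) < (1/2) ^ n"
  obtains T where "T \<in> r_ops P" "\<And>k. rP_norm P (\<sigma> k - T) \<le> 2 * (1/2) ^ k"
proof -
  define D where "D n = \<sigma> (Suc n) - \<sigma> n" for n
  have D: "D n \<in> r_ops P" for n
    unfolding D_def by (intro subspace_diff subspace_r_ops P \<sigma>)
  have "rP_norm P (D n) < (1/2) ^ n" for n
    using fast[of n] rP_norm_minus[of P "D n"] by (simp add: D_def)
  then have "\<exists>S. S \<in> dominating P (D n) \<and> norm S < (1/2) ^ n" for n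
    using rP_norm_lessE[OF P(1) D] by metis
  then obtain S where S: "\<And>n. S n \<in> dominating P (D n)" "\<And>n. norm (S n) < (1/2) ^ n"
    by metis
  have geom: "(\<lambda>n. (1/2) ^ (n + k)) sums (2 * (1/2 :: real) ^ k)" for k
    using sums_mult2[OF geometric_sums[of "1/2 :: real"], of "(1/2) ^ k"] by (simp add: power_add)
  \<comment> \<open>Absolute convergence gives a limit of the series of \<open>S n\<close> in
    operator norm. The series of \<open>D n\<close> follows, since domination bounds
    \<open>norm (D n)\<close> by \<open>norm (S n)\<close>.\<close>
  have "summable (\<lambda>n. norm (S n))"
    by (rule summable_comparison_test'[OF sums_summable[OF geom[of 0]], of 0])
      (use S(2) in \<open>auto intro: less_imp_le\<close>)
  have summ_S: "summable S"
    by (rule summable_norm_cancel) fact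
  have "summable D"
    by (rule summable_comparison_test'[OF \<open>summable (\<lambda>n. norm (S n))\<close>, of 0])
      (rule norm_le_dominating[OF S(1)])
  define T where "T = \<sigma> 0 + suminf D"
  \<comment> \<open>The increments telescope, so the tail from \<open>k\<close> on is exactly the
    error \<open>T - \<sigma> k\<close>.\<close>
  have tail_D: "(\<lambda>n. D (n + k)) sums (T - \<sigma> k)" for k
  proof -
    have "(\<Sum>i<k. D i) = \<sigma> k - \<sigma> 0"
      unfolding D_def by (rule sum_lessThan_telescope)
    then show ?thesis
      using sums_split_initial_segment[OF summable_sums[OF \<open>summable D\<close>], of k]
      by (simp add: T_def diff_diff_eq2 add.commute)
  qed
  define R where "R k = (\<Sum>n. S (n + k))" for k
  have tail_S: "(\<lambda>n. S (n + k)) sums R k" for k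
    unfolding R_def by (intro summable_sums) (simp add: summable_iff_shift summ_S)
  have SP: "S n \<in> P" "D n \<preceq> S n" "- D n \<preceq> S n" for n
    using S(1)[of n] by (auto simp: dominating_def)
  \<comment> \<open>Closedness of \<open>P\<close> puts the sum \<open>R k\<close> into
    \<open>P\<close>; the termwise inequalities for \<open>D n\<close> and \<open>- D n\<close>
    survive summation.\<close>
  have R: "R k \<in> dominating P (T - \<sigma> k)" for k
    unfolding dominating_def
    using sums_in_closed_subspace[OF P SP(1) tail_S]
      op_le_sums[OF tail_D tail_S SP(2)] op_le_sums[OF sums_minus[OF tail_D] tail_S SP(3)]
    by blast
  have norm_R: "norm (R k) \<le> 2 * (1/2) ^ k" for k
  proof -
    have "norm (R k) \<le> (\<Sum>n. (1/2) ^ (n + k))"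
      unfolding R_def
      by (rule norm_suminf_le) (use S(2) geom in \<open>auto intro: less_imp_le sums_summable\<close>)
    then show ?thesis
      using sums_unique[OF geom[of k]] by simp
  qed
  \<comment> \<open>With the dominating operator \<open>R 0\<close>, membership in \<open>P\<close>
    makes \<open>T - \<sigma> 0\<close> an element of \<open>r_ops P\<close>; adding
    \<open>\<sigma> 0\<close> back gives \<open>T\<close>.\<close>
  have "T - \<sigma> k \<in> P" for k
    using D by (intro sums_in_closed_subspace[OF P _ tail_D]) (simp add: r_ops_iff_dominating P)
  then have "T - \<sigma> 0 \<in> r_ops P"
    using R by (auto simp: r_ops_iff_dominating P)
  then have "T - \<sigma> 0 + \<sigma> 0 \<in> r_ops P"
    by (intro subspace_add subspace_r_ops P \<sigma>)
  moreover have "rP_norm P (\<sigma> k - T) \<le> 2 * (1/2) ^ k" for k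
    using rP_norm_le[OF R[of k]] norm_R[of k] rP_norm_minus[of P "T - \<sigma> k"] by simp
  ultimately show thesis
    using that by simp
qed

lemma banach_on_rP_norm:
  assumes "subspace P" "closed P"
  shows "banach_on (r_ops P) (rP_norm P)"
proof -
  interpret Metric_space "r_ops P" "dist_on (r_ops P) (rP_norm P)"
    by (intro Metric_space_dist_on norm_on_rP_norm assms)
  have mcomplete
  proof (rule mcomplete_if_fast_Cauchy_convergent)
    fix \<sigma> assume "range \<sigma> \<subseteq> r_ops P"
      and *: "\<And>n. dist_on (r_ops P) (rP_norm P) (\<sigma> n) (\<sigma> (Suc n)) < (1/2) ^ n"
    then have \<sigma>: "\<sigma> n \<in> r_ops P" for n
      by blast
    then have "rP_norm P (\<sigma> n - \<sigma> (Suc n)) < (1/2) ^ n" for n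
      using *[of n] by (simp add: dist_on_def)
    then obtain T where T: "T \<in> r_ops P" and le: "\<And>k. rP_norm P (\<sigma> k - T) \<le> 2 * (1/2) ^ k"
      using r_ops_fast_Cauchy_convergent[of P \<sigma>] assms \<sigma> by metis
    have "(\<lambda>k. 2 * (1/2 :: real) ^ k) \<longlonglongrightarrow> 0"
      by (intro tendsto_mult_right_zero LIMSEQ_power_zero) simp
    \<comment> \<open>The distance is squeezed between 0 and the tail bound
      \<open>2 * (1/2) ^ k\<close>.\<close>
    then have "(\<lambda>k. dist_on (r_ops P) (rP_norm P) (\<sigma> k) T) \<longlonglongrightarrow> 0"
      by (rule tendsto_sandwich[OF always_eventually always_eventually tendsto_const, rotated 2])
        (intro allI nonneg, use le \<sigma> T in \<open>simp add: dist_on_def\<close>)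
    then show "\<exists>l. limitin mtopology \<sigma> l sequentially"
      using T \<sigma> by (auto simp: limitin_metric_dist_null)
  qed
  then show ?thesis
    by (simp add: banach_on_def norm_on_rP_norm assms)
qed

text \<open>The first conjunct certifies that the infima are over nonempty sets; for the regular
  norm this follows because \<open>dominating P T\<close> is contained in
  \<open>dominating UNIV T\<close>.\<close>

theorem lemma3p3:
  fixes P :: "('a :: banach_lattice \<Rightarrow>\<^sub>L 'a) set"
  assumes "subspace P" and "closed P"
  shows "(\<forall>T \<in> r_ops P. dominating P T \<noteq> {}) \<and>
         norm_on (r_ops P) (rP_norm P) \<and>
         (\<forall>T \<in> r_ops P. rP_norm P T \<ge> regular_norm T \<and> regular_norm T \<ge> norm T) \<and>
         banach_on (r_ops P) (rP_norm P)"
  using assms r_ops_iff_dominating[of P]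
  by (simp add: norm_on_rP_norm regular_norm_le_rP_norm norm_le_regular_norm[of _ P] banach_on_rP_norm)

end
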